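(* Let $(X_t)_{t\in\mathbb{Z}}$ be the CM3 process with parameter functions $a_i^{(j)}$ ($i\in\mathbb{Z}_+$, $j\in\mathbb{Z}$), where $\sum_{j\in\mathbb{Z}}\sum_{i\geqslant 0}\|a_i^{(j)}\|_\infty<\infty$. If $$\sum_{j\in\mathbb{Z}}\sum_{i\geqslant 0} i\,\|a_i^{(j)}\|_\infty<\infty,$$ then $(X_t)_{t\in\mathbb{Z}}$ satisfies the strong mixing condition: $$\lim_{m\to\infty}\ \sup_{A\in\sigma(-\infty,-m),\ B\in\sigma(m,\infty)}\bigl|P(A\cap B)-P(A)P(B)\bigr|=0,$$ where $\sigma(r,s)$ denotes the $\sigma$-field generated by $\{X_t : r\leqslant t\leqslant s\}$.
   Context: Fix an integer $q\geqslant 1$. $\mathbb{Z}_+=\{0,1,2,\ldots\}$, $\mathbb{R}_+=[0,\infty)$. For $f:[0,1]^q\to\mathbb{R}$, $\|f\|_\infty=\sup_{x\in[0,1]^q}|f(x)|$. A unit-Fréchet random variable $Z$ satisfies $P(Z\leqslant z)=\exp(-1/z)$ for $z>0$. CM3 process: let $a_i^{(j)}:[0,1]^q\to(0,\infty)$ ($i\in\mathbb{Z}_+$, $j\in\mathbb{Z}$) be deterministic, strictly positive, continuous functions (the parameter functions) and let $Z_i^{(j)}$ ($i\in\mathbb{Z}$, $j\in\mathbb{Z}$) be independent unit-Fréchet random variables. The CM3 process is $X_t(x)=\sup_{j\in\mathbb{Z}}\sup_{i\geqslant0}(a_i^{(j)}(x)Z_{t-i}^{(j)})$, $x\in[0,1]^q$,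 $t\in\mathbb{Z}$. Under $\sum_{j}\sum_{i\geqslant0}\|a_i^{(j)}\|_\infty<\infty$, $(X_t)_{t\in\mathbb{Z}}$ is a stationary process of random elements (up to null events) of $\mathcal{C}([0,1]^q,\mathbb{R}_+)$, the space of continuous functions $[0,1]^q\to\mathbb{R}_+$ with the sup-norm metric and its Borel $\sigma$-field. *)

theory Defs
  imports "HOL-Probability.Probability"
begin

text \<open>The dimension \<open>q \<ge> 1\<close> is \<open>CARD('q)\<close>, and \<open>cbox 0 1\<close> is the cube \<open>[0,1]^q\<close>.\<close>

abbreviation unit_cube :: "(real^'q) set"
  where "unit_cube \<equiv> cbox 0 1"

definition cube_norm :: "(real^'q \<Rightarrow> real) \<Rightarrow> real"
  where "cube_norm f = (SUP x\<in>unit_cube. \<bar>f x\<bar>)"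

text \<open>Continuous functions from the cube to the nonnegative reals with the sup metric; their
  elements are represented by functions that are \<^const>\<open>extensional\<close> on the cube.\<close>

definition cube_C :: "(real^'q \<Rightarrow> real) metric"
  where "cube_C = cfunspace (top_of_set unit_cube) (submetric euclidean_metric {0..})"

definition metric_borel :: "'a metric \<Rightarrow> 'a measure"
  where "metric_borel m = sigma (mspace m) {U. openin (mtopology_of m) U}"

lemma space_metric_borel: "space (metric_borel m) = mspace m"
  unfolding metric_borel_def
  by (subst space_measure_of) (use openin_subset[of "mtopology_of m"] in auto)

lemma sets_metric_borel:
  "sets (metric_borel m) = sigma_sets (mspace m) {U. openin (mtopology_of m) U}"
  unfolding metric_borel_def
  by (subst sets_measure_of) (use openin_subset[of "mtopology_of m"] in auto)

lemma mtopology_of_nonneg_reals: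
  "mtopology_of (submetric euclidean_metric {0::real..}) = top_of_set {0..}"
  by (simp add: mtopology_of_submetric)

lemma mspace_cube_C:
  "mspace (cube_C :: (real^'q \<Rightarrow> real) metric) =
    {f. f \<in> extensional unit_cube \<and> continuous_on unit_cube f \<and> (\<forall>x\<in>unit_cube. 0 \<le> f x)}"
proof -
  let ?m = "submetric euclidean_metric {0::real..}"
  have bdd: "Metric_space.mbounded (mspace ?m) (mdist ?m) (f ` unit_cube)"
    if "continuous_on unit_cube f" "\<forall>x\<in>unit_cube. 0 \<le> f x" for f :: "real^'q \<Rightarrow> real"
  proof -
    interpret Metric_space "mspace ?m" "mdist ?m" by (rule Metric_space_mspace_mdist)
    have "compactin mtopology (f ` unit_cube)"
    proof -
      have "compactin (top_of_set {0..}) (f ` unit_cube)"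
        using that compact_continuous_image[OF that(1) compact_cbox]
        by (auto simp: compactin_subtopology)
      then show ?thesis
        using mtopology_of_nonneg_reals by (simp add: mtopology_of_def)
    qed
    then show ?thesis
      by (rule compactin_imp_mbounded)
  qed
  show ?thesis
    unfolding cube_C_def mspace_cfunspace mtopology_of_nonneg_reals
    using bdd by (auto simp: continuous_map_in_subtopology Pi_iff image_subset_iff)
qed

text \<open>The index convention is \<open>a i j\<close> for \<open>a\<^sub>i\<^sup>(\<^sup>j\<^sup>)\<close> and \<open>Z i j\<close> for \<open>Z\<^sub>i\<^sup>(\<^sup>j\<^sup>)\<close>. The supremum is
  taken in the extended reals, where it always exists.\<close>

definition CM3_sup ::
    "(nat \<Rightarrow> int \<Rightarrow> real^'q \<Rightarrow> real) \<Rightarrow> (int \<Rightarrow> int \<Rightarrow> 'w \<Rightarrow> real) \<Rightarrow> int \<Rightarrow> 'w \<Rightarrow> real^'q \<Rightarrow> ereal"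
  where "CM3_sup a Z t \<omega> x = (SUP j. SUP i. ereal (a i j x * Z (t - int i) j \<omega>))"

text \<open>The pointwise supremum is a continuous finite nonnegative function only almost surely. On
  the exceptional null event the process is set to the zero function, so that it takes values in
  the function space everywhere.\<close>

definition CM3 ::
    "(nat \<Rightarrow> int \<Rightarrow> real^'q \<Rightarrow> real) \<Rightarrow> (int \<Rightarrow> int \<Rightarrow> 'w \<Rightarrow> real) \<Rightarrow> int \<Rightarrow> 'w \<Rightarrow> real^'q \<Rightarrow> real"
  where "CM3 a Z t \<omega> =
    (let f = (\<lambda>x\<in>unit_cube. real_of_ereal (CM3_sup a Z t \<omega> x)) in
     if (\<forall>x\<in>unit_cube. \<bar>CM3_sup a Z t \<omega> x\<bar> \<noteq> \<infinity>) \<and> f \<in> mspace cube_C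
     then f else (\<lambda>x\<in>unit_cube. 0))"

definition unit_Frechet :: "'w measure \<Rightarrow> ('w \<Rightarrow> real) \<Rightarrow> bool"
  where "unit_Frechet M Y \<longleftrightarrow>
    Y \<in> borel_measurable M \<and> (\<forall>z>0. measure M {\<omega>\<in>space M. Y \<omega> \<le> z} = exp (- 1 / z))"

definition gen_sigma :: "'w measure \<Rightarrow> 's measure \<Rightarrow> (int \<Rightarrow> 'w \<Rightarrow> 's) \<Rightarrow> int set \<Rightarrow> 'w set set"
  where "gen_sigma M N X T = sigma_sets (space M) (\<Union>t\<in>T. {X t -` B \<inter> space M |B. B \<in> sets N})"

definition mixing_coeff :: "'w measure \<Rightarrow> 's measure \<Rightarrow> (int \<Rightarrow> 'w \<Rightarrow> 's) \<Rightarrow> nat \<Rightarrow> real"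
  where "mixing_coeff M N X m =
    (SUP (A, B) \<in> gen_sigma M N X {..- int m} \<times> gen_sigma M N X {int m..}.
       \<bar>measure M (A \<inter> B) - measure M A * measure M B\<bar>)"

definition strong_mixing :: "'w measure \<Rightarrow> 's measure \<Rightarrow> (int \<Rightarrow> 'w \<Rightarrow> 's) \<Rightarrow> bool"
  where "strong_mixing M N X \<longleftrightarrow> mixing_coeff M N X \<longlonglongrightarrow> 0"

end

theory Submission
  imports Defs
begin

text \<open>
The idea is that the newest noise hides the distant past. For \<open>t > 0\<close> compare \<open>X\<^sub>t\<close> with the process \<open>X'\<^sub>t\<close>
obtained by deleting all noise at times \<open>s \<le> 0\<close>. The deleted terms are those with \<open>i \<ge> t\<close>. Let \<open>c > 0\<close> be the
minimum of \<open>a\<^sub>0\<^sup>(\<^sup>0\<^sup>)\<close> on the cube. If \<open>Z\<^sub>t\<^sup>(\<^sup>0\<^sup>) \<ge> 0\<close>, which is almost sure, and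
\<open>\<parallel>a\<^sub>i\<^sup>(\<^sup>j\<^sup>)\<parallel> Z\<^sub>t\<^sub>-\<^sub>i\<^sup>(\<^sup>j\<^sup>) \<le> c Z\<^sub>t\<^sup>(\<^sup>0\<^sup>)\<close> for all \<open>j\<close> and all \<open>i \<ge> t\<close>, then at every point of the cube the deleted
terms lie below \<open>a\<^sub>0\<^sup>(\<^sup>0\<^sup>) Z\<^sub>t\<^sup>(\<^sup>0\<^sup>)\<close>, so that \<open>X\<^sub>t = X'\<^sub>t\<close> (lemma \<open>CM3_eq_after_zero\<close>).

Two independent unit Frechet variables satisfy \<open>P(W < l Y) = O(l)\<close> (lemma \<open>prob_Frechet_less_le\<close>), so one such
inequality fails with probability \<open>O(\<parallel>a\<^sub>i\<^sup>(\<^sup>j\<^sup>)\<parallel>)\<close>. A pair \<open>(i, j)\<close> is involved, among the times \<open>t \<ge> m\<close>, only for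
\<open>m \<le> t \<le> i\<close>, hence the probability that \<open>X\<^sub>t \<noteq> X'\<^sub>t\<close> for some \<open>t \<ge> m\<close> is at most a constant times the tail
\<open>\<Sum>\<^sub>j \<Sum>\<^sub>i\<^sub>\<ge>\<^sub>m i \<parallel>a\<^sub>i\<^sup>(\<^sup>j\<^sup>)\<parallel>\<close> (lemma \<open>prob_old_noise_visible_le\<close>), which tends to \<open>0\<close>. The process \<open>X'\<close> uses noise at times
\<open>s > 0\<close> and is independent of the past of \<open>X\<close> up to time \<open>-m\<close>, so the mixing coefficient is at most twice this
probability (lemma \<open>mixing_coeff_CM3_le\<close>).

Independence of the generated \<open>\<sigma>\<close>-fields requires that \<open>X\<^sub>t\<close> is measurable, as a map into the Borel space of
the sup metric, with respect to the noise variables that enter it. Since the process is reset to zero where the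
supremum is infinite, discontinuous or somewhere negative, this includes measurability of that exceptional set. It follows from
Dini's theorem (lemmas \<open>real_sup_continuous_iff\<close> and \<open>measurable_sup_process\<close>).
\<close>

section \<open>Suprema of continuous functions\<close>

text \<open>Dini's theorem in a form free of limits: a supremum of continuous functions on a compact set is
finite and continuous iff finitely many of the functions come within any given \<open>\<epsilon>\<close> of all of them,
uniformly in the point. Forwards, every point has a neighbourhood on which a single function
is \<open>\<epsilon>\<close>-close to the supremum, and compactness selects finitely many of these. Backwards, the
supremum is a uniform limit of finite maxima. The right-hand side only compares values of the
functions with each other, which is what makes it a measurable condition on random coefficients.\<close>

lemma real_sup_continuous_iff:
  fixes c :: "'k \<Rightarrow> 'a::topological_space \<Rightarrow> real"
  assumes K: "compact K" and cont: "\<And>k. continuous_on K (c k)"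
  defines "g \<equiv> (\<lambda>x. SUP k. ereal (c k x))"
  shows "(\<forall>x\<in>K. \<bar>g x\<bar> \<noteq> \<infinity>) \<and> continuous_on K (\<lambda>x. real_of_ereal (g x)) \<longleftrightarrow>
    (\<forall>p::nat. \<exists>F. finite F \<and> (\<forall>x\<in>K. \<forall>l. \<exists>k\<in>F. c l x \<le> c k x + 1 / Suc p))"
    (is "?fin \<and> ?cont \<longleftrightarrow> ?uni")
proof
  assume fc: "?fin \<and> ?cont"
  define f where "f = (\<lambda>x. real_of_ereal (g x))"
  have f: "g x = ereal (f x)" if "x \<in> K" for x
    using fc that by (simp add: f_def ereal_real)
  have le: "c k x \<le> f x" if "x \<in> K" for k x
    using f[OF that] SUP_upper[of k UNIV "\<lambda>k. ereal (c k x)"] by (simp add: g_def)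
  have contf: "continuous_on K f" using fc by (simp add: f_def)
  show ?uni
  proof
    fix p :: nat
    define e where "e = 1 / real (Suc p)"
    have e: "e > 0" by (simp add: e_def)
    have "\<exists>k. c k x > f x - e" if "x \<in> K" for x
    proof -
      have "ereal (f x - e) < (SUP k. ereal (c k x))"
        using f[OF that] e by (simp add: g_def)
      then show ?thesis by (auto simp: less_SUP_iff)
    qed
    then obtain k where k: "\<And>x. x \<in> K \<Longrightarrow> f x - e < c (k x) x" by metis
    have "\<exists>U. open U \<and> U \<inter> K = {y\<in>K. f y - e < c (k x) y}" for x
    proof -
      have "continuous_on K (\<lambda>y. c (k x) y - f y)"
        by (intro continuous_intros cont contf)
      then obtain U where "open U" "U \<inter> K = (\<lambda>y. c (k x) y - f y) -` {-e<..} \<inter> K"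
        using continuous_on_open_invariant open_greaterThan by metis
      then show ?thesis by (intro exI[of _ U]) auto
    qed
    then obtain U where U: "\<And>x. open (U x)" "\<And>x. U x \<inter> K = {y\<in>K. f y - e < c (k x) y}"
      by metis
    have "K \<subseteq> (\<Union>x\<in>K. U x)" using U(2) k by blast
    then obtain C where C: "C \<subseteq> K" "finite C" "K \<subseteq> (\<Union>x\<in>C. U x)"
      using compactE_image[OF K, of K U] U(1) by metis
    show "\<exists>F. finite F \<and> (\<forall>x\<in>K. \<forall>l. \<exists>k\<in>F. c l x \<le> c k x + 1 / Suc p)"
    proof (intro exI[of _ "k ` C"] conjI ballI allI)
      show "finite (k ` C)" using C by simp
      fix y l assume y: "y \<in> K"
      then obtain x where "x \<in> C" "y \<in> U x" using C by blast
      then have "f y - e < c (k x) y" using U(2)[of x] y by blast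
      then have "c l y \<le> c (k x) y + 1 / Suc p"
        using le[OF y, of l] by (simp add: e_def)
      then show "\<exists>k\<in>k ` C. c l y \<le> c k y + 1 / Suc p"
        using \<open>x \<in> C\<close> by blast
    qed
  qed
next
  assume u: ?uni
  have approx: "\<exists>F. finite F \<and> (\<forall>x\<in>K. \<exists>k\<in>F. g x \<le> ereal (c k x + e))" if "e > 0" for e :: real
  proof -
    obtain p where p: "1 / real (Suc p) < e"
      using nat_approx_posE[OF \<open>e > 0\<close>] .
    obtain F where F: "finite F" "\<And>x l. x \<in> K \<Longrightarrow> \<exists>k\<in>F. c l x \<le> c k x + 1 / Suc p"
      using u[rule_format, of p] by metis
    show ?thesis
    proof (intro exI[of _ F] conjI ballI F)
      fix x assume x: "x \<in> K"
      \<comment> \<open>The index attaining the maximum over \<open>F\<close> serves for all \<open>l\<close> at once.\<close>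
      have "F \<noteq> {}" using F(2)[OF x] by auto
      then obtain k where k: "k \<in> F" "\<And>k'. k' \<in> F \<Longrightarrow> c k' x \<le> c k x"
        using F(1) Max_in[of "(\<lambda>k. c k x) ` F"] Max_ge[of "(\<lambda>k. c k x) ` F"] by fastforce
      have "c l x \<le> c k x + e" for l
        using F(2)[OF x, of l] k p by force
      then show "\<exists>k\<in>F. g x \<le> ereal (c k x + e)"
        unfolding g_def by (intro bexI[OF _ k(1)] SUP_least) simp
    qed
  qed
  have ge: "ereal (c k x) \<le> g x" for k x by (auto simp: g_def intro: SUP_upper)
  have fin: "\<bar>g x\<bar> \<noteq> \<infinity>" if x: "x \<in> K" for x
  proof -
    obtain k where "g x \<le> ereal (c k x + 1)" using approx[OF zero_less_one] x by blast
    then show ?thesis using ge[of undefined x] by auto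
  qed
  define f where "f = (\<lambda>x. real_of_ereal (g x))"
  have f: "g x = ereal (f x)" if "x \<in> K" for x
    using fin that by (simp add: f_def ereal_real)
  have "continuous_on K f"
    unfolding continuous_on_def
  proof (intro ballI tendstoI)
    fix x e assume x: "x \<in> K" and "(0::real) < e"
    then have e: "e / 3 > 0" by simp
    obtain F where F: "finite F" "\<And>x. x \<in> K \<Longrightarrow> \<exists>k\<in>F. g x \<le> ereal (c k x + e / 3)"
      using approx[OF e] by blast
    have "\<forall>\<^sub>F y in at x within K. \<forall>k\<in>F. dist (c k y) (c k x) < e / 3"
    proof (intro eventually_ball_finite F ballI)
      show "\<forall>\<^sub>F y in at x within K. dist (c k y) (c k x) < e / 3" for k
        using cont[of k] x e unfolding continuous_on_def tendsto_iff by blast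
    qed
    moreover have "\<forall>\<^sub>F y in at x within K. y \<in> K"
      by (auto simp: eventually_at_topological)
    ultimately show "\<forall>\<^sub>F y in at x within K. dist (f y) (f x) < e"
    proof eventually_elim
      case (elim y)
      obtain k where k: "k \<in> F" "f x \<le> c k x + e / 3" using F(2)[OF x] f[OF x] by auto
      obtain k' where k': "k' \<in> F" "f y \<le> c k' y + e / 3"
        using F(2)[of y] f[of y] elim by auto
      have "c k y \<le> f y" "c k' x \<le> f x" using ge f x elim by (metis ereal_less_eq(3))+
      moreover have "\<bar>c k y - c k x\<bar> < e / 3" "\<bar>c k' y - c k' x\<bar> < e / 3"
        using elim(1) k(1) k'(1) by (auto simp: dist_real_def)
      ultimately show ?case using k(2) k'(2) e unfolding dist_real_def by linarith
    qed
  qed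
  then show "?fin \<and> ?cont" using fin by (simp add: f_def)
qed

text \<open>For a finite \<open>F\<close> the points at which a given \<open>c l\<close> is nearly dominated form a finite union of closed
sets, so a dense set of test points suffices. For a countable index type
the condition of the previous lemma then quantifies over countable sets only.\<close>

lemma uniform_sup_dense:
  fixes c :: "'k \<Rightarrow> 'a::topological_space \<Rightarrow> real"
  assumes K: "closed K" and cont: "\<And>k. continuous_on K (c k)"
    and D: "D \<subseteq> K" "K \<subseteq> closure D" and F: "finite F"
  shows "(\<forall>x\<in>K. \<forall>l. \<exists>k\<in>F. c l x \<le> c k x + e) \<longleftrightarrow> (\<forall>x\<in>D. \<forall>l. \<exists>k\<in>F. c l x \<le> c k x + e)"
proof
  assume *: "\<forall>x\<in>D. \<forall>l. \<exists>k\<in>F. c l x \<le> c k x + e"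
  have "K \<subseteq> {x\<in>K. \<exists>k\<in>F. c l x \<le> c k x + e}" for l
  proof -
    have "closed {x\<in>K. c l x \<le> c k x + e}" for k
      by (intro continuous_on_closed_Collect_le K continuous_intros cont)
    then have "closed (\<Union>k\<in>F. {x\<in>K. c l x \<le> c k x + e})"
      using F by (intro closed_UN) auto
    moreover have "D \<subseteq> (\<Union>k\<in>F. {x\<in>K. c l x \<le> c k x + e})" using * D by blast
    ultimately have "closure D \<subseteq> (\<Union>k\<in>F. {x\<in>K. c l x \<le> c k x + e})"
      by (simp add: closure_minimal)
    then show ?thesis using D by blast
  qed
  then show "\<forall>x\<in>K. \<forall>l. \<exists>k\<in>F. c l x \<le> c k x + e" by blast
qed (use D in blast)

lemma le_on_dense:
  fixes h :: "'a::topological_space \<Rightarrow> real"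
  assumes "closed K" "continuous_on K h" "D \<subseteq> K" "K \<subseteq> closure D"
  shows "(\<forall>x\<in>K. h x \<le> r) \<longleftrightarrow> (\<forall>x\<in>D. h x \<le> r)"
proof -
  have "closed {x\<in>K. h x \<le> r}"
    by (intro continuous_on_closed_Collect_le assms continuous_intros)
  then show ?thesis
    using assms closure_minimal[of D "{x\<in>K. h x \<le> r}"] by blast
qed

section \<open>Measurability of the process\<close>

lemma mdist_cube_C_le:
  fixes f g :: "real^'q \<Rightarrow> real"
  assumes "f \<in> mspace cube_C" "g \<in> mspace cube_C"
  shows "mdist cube_C f g \<le> r \<longleftrightarrow> (\<forall>x\<in>unit_cube. \<bar>f x - g x\<bar> \<le> r)"
proof -
  have "(0 :: real^'q) \<in> unit_cube"
    by (auto simp: mem_box_cart)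
  then show ?thesis
    using cfunspace_mdist_le[of f "top_of_set unit_cube" "submetric euclidean_metric {0::real..}" g r] assms
    unfolding cube_C_def by (auto simp: dist_real_def simp del: mspace_cfunspace)
qed

text \<open>In a metric space that need not be separable, measurability of the distances to single points does not
control preimages of arbitrary open sets. It does so for a map that takes its values in the closure
of a countable set \<open>Q\<close>: the part of an open \<open>U\<close> that the map can reach is covered by the countably many
balls inside \<open>U\<close> with centre in \<open>Q\<close> and radius \<open>1/(n+1)\<close>.\<close>

lemma measurable_metric_borelI:
  assumes X: "\<And>\<omega>. \<omega> \<in> space M \<Longrightarrow> X \<omega> \<in> mspace m"
    and Q: "countable Q" "Q \<subseteq> mspace m"
    and approx: "\<And>\<omega> e. \<omega> \<in> space M \<Longrightarrow> e > 0 \<Longrightarrow> \<exists>q\<in>Q. mdist m q (X \<omega>) \<le> e"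
    and dist: "\<And>q. q \<in> Q \<Longrightarrow> (\<lambda>\<omega>. mdist m q (X \<omega>)) \<in> borel_measurable M"
  shows "X \<in> measurable M (metric_borel m)"
  unfolding metric_borel_def
proof -
  interpret m: Metric_space "mspace m" "mdist m" by (rule Metric_space_mspace_mdist)
  show "X \<in> measurable M (sigma (mspace m) {U. openin (mtopology_of m) U})"
  proof (rule measurable_measure_of)
    show "{U. openin (mtopology_of m) U} \<subseteq> Pow (mspace m)"
      using openin_subset[of "mtopology_of m"] by auto
    show "X \<in> space M \<rightarrow> mspace m" using X by auto
    fix U assume "U \<in> {U. openin (mtopology_of m) U}"
    then have U: "\<And>x. x \<in> U \<Longrightarrow> \<exists>r>0. m.mball x r \<subseteq> U" "U \<subseteq> mspace m"
      using m.openin_mtopology by (auto simp: mtopology_of_def)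
    define I where "I = {(q, n). q \<in> Q \<and> m.mball q (1 / real (Suc n)) \<subseteq> U}"
    have "countable I"
      by (rule countable_subset[of _ "Q \<times> UNIV"]) (auto simp: I_def Q)
    have "X -` U \<inter> space M = (\<Union>(q, n)\<in>I. {\<omega>\<in>space M. mdist m q (X \<omega>) < 1 / Suc n})" (is "?L = ?R")
    proof
      show "?R \<subseteq> ?L" using X Q by (auto simp: I_def m.mball_def subset_iff)
      show "?L \<subseteq> ?R"
      proof
        fix \<omega> assume "\<omega> \<in> ?L"
        then have w: "\<omega> \<in> space M" "X \<omega> \<in> U" by auto
        obtain r where r: "r > 0" "m.mball (X \<omega>) r \<subseteq> U" using U(1)[OF w(2)] by auto
        obtain n where n: "1 / real (Suc n) < r / 2" using nat_approx_posE[of "r/2"] r by auto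
        obtain q where q: "q \<in> Q" "mdist m q (X \<omega>) \<le> 1 / (2 * Suc n)"
          using approx[OF w(1), of "1 / (2 * Suc n)"] by auto
        have lt: "mdist m q (X \<omega>) < 1 / Suc n"
          by (rule le_less_trans[OF q(2)]) (simp add: field_simps)
        have "m.mball q (1 / real (Suc n)) \<subseteq> m.mball (X \<omega>) r"
        proof
          fix y assume "y \<in> m.mball q (1 / real (Suc n))"
          then have y: "y \<in> mspace m" "mdist m q y < 1 / Suc n" by auto
          have "mdist m (X \<omega>) y \<le> mdist m q (X \<omega>) + mdist m q y"
            using m.triangle[of "X \<omega>" q y] X[OF w(1)] q(1) Q y(1) m.commute by (metis subsetD)
          then show "y \<in> m.mball (X \<omega>) r" using y lt n X[OF w(1)] by auto
        qed
        then have "(q, n) \<in> I" using q r by (auto simp: I_def)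
        then show "\<omega> \<in> ?R" using lt w by auto
      qed
    qed
    also have "?R \<in> sets M"
    proof -
      have "{\<omega>\<in>space M. mdist m q (X \<omega>) < 1 / Suc n} \<in> sets M" if "q \<in> Q" for q n
      proof -
        have [measurable]: "(\<lambda>\<omega>. mdist m q (X \<omega>)) \<in> borel_measurable M" using that dist by simp
        show ?thesis by measurable
      qed
      then show ?thesis
        by (intro sets.countable_UN'' \<open>countable I\<close>) (auto simp: I_def)
    qed
    finally show "X -` U \<inter> space M \<in> sets M" .
  qed
qed

text \<open>The finite maxima with rational coefficients, cut off below at \<open>0\<close>. Lists of pairs index them by a
countable type, and the cut-off keeps them in the function space whatever the signs of the
coefficients; the empty list gives the zero function.\<close>

definition rational_max :: "('k \<Rightarrow> 'a \<Rightarrow> real) \<Rightarrow> ('k \<times> rat) list \<Rightarrow> 'a \<Rightarrow> real"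
  where "rational_max b qs x = Max (insert 0 ((\<lambda>(k, r). b k x * of_rat r) ` set qs))"

lemma continuous_on_rational_max:
  assumes "\<And>k. continuous_on K (b k)"
  shows "continuous_on K (rational_max b qs)"
proof (induction qs)
  case Nil
  then show ?case by (simp add: rational_max_def[abs_def])
next
  case (Cons kr qs)
  obtain k r where kr: "kr = (k, r)" by (cases kr)
  have "rational_max b (kr # qs) = (\<lambda>x. max (b k x * of_rat r) (rational_max b qs x))"
    by (rule ext) (simp add: rational_max_def kr insert_commute[of 0])
  then show ?case
    using Cons by (auto intro!: continuous_intros assms)
qed

lemma rational_max_in_cube_C:
  fixes b :: "'k \<Rightarrow> real^'q \<Rightarrow> real"
  assumes "\<And>k. continuous_on unit_cube (b k)"
  shows "restrict (rational_max b qs) unit_cube \<in> mspace cube_C"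
proof -
  have "0 \<le> rational_max b qs x" for x by (simp add: rational_max_def)
  moreover have "continuous_on unit_cube (restrict (rational_max b qs) unit_cube)"
    using continuous_on_rational_max[of unit_cube b qs] assms by (simp cong: continuous_on_cong)
  ultimately show ?thesis by (simp add: mspace_cube_C)
qed

text \<open>By the uniform domination by finitely many indices, a continuous nonnegative supremum is
\<open>\<epsilon>\<close>-close to a finite maximum, and on a compact set rational coefficients close enough to the true ones
change the finitely many terms uniformly little.\<close>

lemma rational_max_approx:
  fixes b :: "'k \<Rightarrow> 'a::topological_space \<Rightarrow> real" and v :: "'k \<Rightarrow> real"
  assumes K: "compact K" and cont: "\<And>k. continuous_on K (b k)"
    and sup: "\<And>x. x \<in> K \<Longrightarrow> (SUP k. ereal (b k x * v k)) = ereal (f x)"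
    and f: "continuous_on K f" "\<And>x. x \<in> K \<Longrightarrow> 0 \<le> f x" and e: "0 < e"
  shows "\<exists>qs. \<forall>x\<in>K. \<bar>rational_max b qs x - f x\<bar> \<le> e"
proof -
  have contc: "continuous_on K (\<lambda>x. b k x * v k)" for k by (intro continuous_intros cont)
  obtain p where p: "1 / real (Suc p) < e / 4" using nat_approx_posE[of "e/4"] e by auto
  have "continuous_on K (\<lambda>x. real_of_ereal (SUP k. ereal (b k x * v k)))"
    using f(1) sup by (simp cong: continuous_on_cong)
  then have "\<forall>p::nat. \<exists>F. finite F \<and> (\<forall>x\<in>K. \<forall>l. \<exists>k\<in>F. b l x * v l \<le> b k x * v k + 1 / Suc p)"
    using real_sup_continuous_iff[OF K, of "\<lambda>k x. b k x * v k"] contc sup by auto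
  then obtain F where F: "finite F" "\<And>x l. x \<in> K \<Longrightarrow> \<exists>k\<in>F. b l x * v l \<le> b k x * v k + 1 / Suc p"
    by metis
  have "\<exists>r. \<forall>x\<in>K. \<bar>b k x * of_rat r - b k x * v k\<bar> \<le> e / 4" for k
  proof -
    have "bounded (b k ` K)" using compact_continuous_image[OF cont K] compact_imp_bounded by blast
    then obtain B where B: "B > 0" "\<And>x. x \<in> K \<Longrightarrow> \<bar>b k x\<bar> \<le> B"
      unfolding bounded_pos by auto
    obtain r where r: "v k < of_rat r" "of_rat r < v k + e / 4 / B"
      using of_rat_dense[of "v k" "v k + e / 4 / B"] B(1) e by auto
    have "\<bar>b k x * of_rat r - b k x * v k\<bar> \<le> e / 4" if "x \<in> K" for x
    proof -
      have "\<bar>b k x * of_rat r - b k x * v k\<bar> = \<bar>b k x\<bar> * (of_rat r - v k)"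
        using r by (simp add: abs_mult flip: right_diff_distrib)
      also have "\<dots> \<le> B * (e / 4 / B)" using B(2)[OF that] r B(1) by (intro mult_mono) auto
      finally show ?thesis using B by simp
    qed
    then show ?thesis by blast
  qed
  then obtain r where r: "\<And>k x. x \<in> K \<Longrightarrow> \<bar>b k x * of_rat (r k) - b k x * v k\<bar> \<le> e / 4" by metis
  obtain ks where ks: "set ks = F" using finite_list F(1) by blast
  define qs where "qs = map (\<lambda>k. (k, r k)) ks"
  have "\<bar>rational_max b qs x - f x\<bar> \<le> e" if x: "x \<in> K" for x
  proof -
    let ?S = "insert 0 ((\<lambda>k. b k x * of_rat (r k)) ` F)"
    have Mx: "rational_max b qs x = Max ?S"
      by (simp add: rational_max_def qs_def ks image_image flip: ks)
    have le: "b k x * v k \<le> f x" for k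
      using SUP_upper[of k UNIV "\<lambda>k. ereal (b k x * v k)"] sup[OF x] by simp
    have "b k x * of_rat (r k) \<le> f x + e / 4" for k
      using r[OF x, of k] le[of k] by linarith
    then have "Max ?S \<le> f x + e / 4"
      using F(1) f(2)[OF x] e by auto
    moreover have "f x - e \<le> Max ?S"
    proof -
      have "ereal (f x - e / 4) < (SUP k. ereal (b k x * v k))" using sup[OF x] e by simp
      then obtain l where l: "f x - e / 4 < b l x * v l" by (auto simp: less_SUP_iff)
      obtain k where k: "k \<in> F" "b l x * v l \<le> b k x * v k + 1 / Suc p" using F(2)[OF x] by blast
      have "b k x * of_rat (r k) \<le> Max ?S" using F(1) k(1) by (intro Max_ge) auto
      then show ?thesis using l k(2) p r[OF x, of k] by linarith
    qed
    ultimately show ?thesis using e Mx by linarith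
  qed
  then show ?thesis by blast
qed

text \<open>The CM3 process at a fixed time, with the double supremum taken over a single index type and
the random coefficients replaced by a deterministic family \<open>v\<close>.\<close>

definition sup_process :: "('k \<Rightarrow> real^'q \<Rightarrow> real) \<Rightarrow> ('k \<Rightarrow> real) \<Rightarrow> real^'q \<Rightarrow> real"
  where "sup_process b v =
    (let g = (\<lambda>x. SUP k. ereal (b k x * v k)); f = (\<lambda>x\<in>unit_cube. real_of_ereal (g x)) in
     if (\<forall>x\<in>unit_cube. \<bar>g x\<bar> \<noteq> \<infinity>) \<and> f \<in> mspace cube_C then f else (\<lambda>x\<in>unit_cube. 0))"

lemma CM3_eq_sup_process:
  "CM3 a Z t \<omega> = sup_process (\<lambda>(i, j). a i j) (\<lambda>(i, j). Z (t - int i) j \<omega>)"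
proof -
  have "CM3_sup a Z t \<omega> x =
      (SUP k. ereal ((case k of (i, j) \<Rightarrow> a i j) x * (case k of (i, j) \<Rightarrow> Z (t - int i) j \<omega>)))"
    for x
    unfolding CM3_sup_def
    by (rule antisym)
       (auto intro!: SUP_least intro: SUP_upper2[where i = "(i, j)" for i j] SUP_upper2)
  then show ?thesis by (simp add: CM3_def sup_process_def)
qed

lemma ex_finite_iff_ex_list: "(\<exists>xs. P (set xs)) \<longleftrightarrow> (\<exists>F. finite F \<and> P F)"
  by (auto dest!: finite_list)

text \<open>Measurability has to hold exactly, not only almost surely, because \<open>M\<close> need not be complete and
a nonmeasurable event would have measure \<open>0\<close> by default. So the event on which the
process is reset to zero must itself be measurable. This is the predicate \<open>good\<close>: by Dini's theorem it
is described by countably many comparisons at the points of a countable dense set. Values of the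
process lie in the closure of the rational finite maxima, and distances to those are determined by
the same countable set of points.\<close>

lemma measurable_sup_process:
  fixes b :: "'k::countable \<Rightarrow> real^'q \<Rightarrow> real"
  assumes cont: "\<And>k. continuous_on unit_cube (b k)"
    and W[measurable]: "\<And>k. (\<lambda>\<omega>. v \<omega> k) \<in> borel_measurable M"
  shows "(\<lambda>\<omega>. sup_process b (v \<omega>)) \<in> measurable M (metric_borel cube_C)"
proof -
  let ?K = "unit_cube :: (real^'q) set"
  obtain D :: "(real^'q) set" where D: "countable D" "D \<subseteq> ?K" "?K \<subseteq> closure D"
    using separable by metis
  have "0 \<in> ?K" by (auto simp: mem_box_cart)
  then have "D \<noteq> {}" using D(3) by auto
  define d where "d = from_nat_into D"
  have d: "range d = D" using D \<open>D \<noteq> {}\<close> by (simp add: d_def range_from_nat_into)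
  then have dK: "d n \<in> ?K" for n using D by auto
  define g where "g = (\<lambda>\<omega> x. SUP k. ereal (b k x * v \<omega> k))"
  define good where "good \<omega> \<longleftrightarrow> (\<forall>p::nat. \<exists>ks. \<forall>n. \<forall>l. \<exists>k\<in>set ks.
      b l (d n) * v \<omega> l \<le> b k (d n) * v \<omega> k + 1 / Suc p) \<and> (\<forall>n. 0 \<le> real_of_ereal (g \<omega> (d n)))" for \<omega>
  have gm[measurable]: "(\<lambda>\<omega>. g \<omega> x) \<in> borel_measurable M" for x
    unfolding g_def by measurable
  have goodm[measurable]: "Measurable.pred M good"
    unfolding good_def by measurable
  have dense: "(\<forall>x\<in>?K. h x \<le> r) \<longleftrightarrow> (\<forall>n. h (d n) \<le> r)" if "continuous_on ?K h" for h :: "real^'q \<Rightarrow> real" and r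
    using le_on_dense[OF closed_cbox that D(2,3), of r] d by auto
  have good: "good \<omega> \<longleftrightarrow> (\<forall>x\<in>?K. \<bar>g \<omega> x\<bar> \<noteq> \<infinity>) \<and> (\<lambda>x\<in>?K. real_of_ereal (g \<omega> x)) \<in> mspace cube_C"
    for \<omega>
  proof -
    have contc: "continuous_on ?K (\<lambda>x. b k x * v \<omega> k)" for k by (intro continuous_intros cont)
    have "(\<exists>ks. \<forall>n. \<forall>l. \<exists>k\<in>set ks. b l (d n) * v \<omega> l \<le> b k (d n) * v \<omega> k + 1 / Suc p) \<longleftrightarrow>
        (\<exists>F. finite F \<and> (\<forall>x\<in>?K. \<forall>l. \<exists>k\<in>F. b l x * v \<omega> l \<le> b k x * v \<omega> k + 1 / Suc p))" for p
    proof -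
      have eq: "(\<forall>n. \<forall>l. \<exists>k\<in>F. b l (d n) * v \<omega> l \<le> b k (d n) * v \<omega> k + 1 / Suc p) \<longleftrightarrow>
          (\<forall>x\<in>?K. \<forall>l. \<exists>k\<in>F. b l x * v \<omega> l \<le> b k x * v \<omega> k + 1 / Suc p)" if "finite F" for F
        using uniform_sup_dense[where c = "\<lambda>k x. b k x * v \<omega> k" and e = "1 / real (Suc p)",
            OF closed_cbox contc D(2,3) that]
        unfolding d[symmetric] by simp
      show ?thesis
        unfolding eq[OF finite_set] by (rule ex_finite_iff_ex_list)
    qed
    then have "(\<forall>p::nat. \<exists>ks. \<forall>n. \<forall>l. \<exists>k\<in>set ks.
        b l (d n) * v \<omega> l \<le> b k (d n) * v \<omega> k + 1 / Suc p) \<longleftrightarrow>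
        (\<forall>x\<in>?K. \<bar>g \<omega> x\<bar> \<noteq> \<infinity>) \<and> continuous_on ?K (\<lambda>x. real_of_ereal (g \<omega> x))"
      using real_sup_continuous_iff[OF compact_cbox, of 0 1 "\<lambda>k x. b k x * v \<omega> k"] contc
      by (simp add: g_def)
    moreover have "(\<forall>n. 0 \<le> real_of_ereal (g \<omega> (d n))) \<longleftrightarrow> (\<forall>x\<in>?K. 0 \<le> real_of_ereal (g \<omega> x))"
      if "continuous_on ?K (\<lambda>x. real_of_ereal (g \<omega> x))"
      using dense[of "\<lambda>x. - real_of_ereal (g \<omega> x)" 0] that by (simp add: continuous_on_minus)
    moreover have "continuous_on ?K (\<lambda>x\<in>?K. real_of_ereal (g \<omega> x)) \<longleftrightarrow>
        continuous_on ?K (\<lambda>x. real_of_ereal (g \<omega> x))"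
      by (rule continuous_on_cong) auto
    ultimately show ?thesis unfolding good_def mspace_cube_C by auto
  qed
  have X: "sup_process b (v \<omega>) = (if good \<omega> then \<lambda>x\<in>?K. real_of_ereal (g \<omega> x) else (\<lambda>x\<in>?K. 0))" for \<omega>
    using good[of \<omega>] by (simp add: sup_process_def g_def Let_def)
  have Xin: "sup_process b (v \<omega>) \<in> mspace cube_C" for \<omega>
    using good[of \<omega>] by (auto simp: X mspace_cube_C)
  have Xm[measurable]: "(\<lambda>\<omega>. sup_process b (v \<omega>) (d n)) \<in> borel_measurable M" for n
  proof -
    have "sup_process b (v \<omega>) (d n) = (if good \<omega> then real_of_ereal (g \<omega> (d n)) else 0)" for \<omega>
      using dK by (simp add: X)
    then show ?thesis by simp
  qed
  show ?thesis
  proof (rule measurable_metric_borelI[where Q = "range (\<lambda>qs. restrict (rational_max b qs) ?K)"])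
    show "range (\<lambda>qs. restrict (rational_max b qs) ?K) \<subseteq> mspace cube_C"
      using rational_max_in_cube_C[of b] cont by auto
  next
    fix \<omega> and e :: real assume e: "e > 0"
    have "\<exists>qs. \<forall>x\<in>?K. \<bar>rational_max b qs x - sup_process b (v \<omega>) x\<bar> \<le> e"
    proof (cases "good \<omega>")
      case True
      show ?thesis
      proof (rule rational_max_approx[where v = "v \<omega>"])
        show "(SUP k. ereal (b k x * v \<omega> k)) = ereal (sup_process b (v \<omega>) x)" if "x \<in> ?K" for x
          using True good[of \<omega>] that by (auto simp: X g_def ereal_real)
      qed (use Xin[of \<omega>] cont e in \<open>auto simp: mspace_cube_C\<close>)
    next
      case False
      then show ?thesis using e by (intro exI[of _ "[]"]) (simp add: X rational_max_def)
    qed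
    then obtain qs where "\<forall>x\<in>?K. \<bar>rational_max b qs x - sup_process b (v \<omega>) x\<bar> \<le> e" by blast
    then have "mdist cube_C (restrict (rational_max b qs) ?K) (sup_process b (v \<omega>)) \<le> e"
      using mdist_cube_C_le[OF rational_max_in_cube_C[of b] Xin] cont by simp
    then show "\<exists>q\<in>range (\<lambda>qs. restrict (rational_max b qs) ?K). mdist cube_C q (sup_process b (v \<omega>)) \<le> e"
      by blast
  next
    fix q assume "q \<in> range (\<lambda>qs. restrict (rational_max b qs) ?K)"
    then have q: "q \<in> mspace cube_C" using rational_max_in_cube_C[of b] cont by auto
    have "mdist cube_C q (sup_process b (v \<omega>)) \<le> r \<longleftrightarrow>
        (\<forall>n. \<bar>q (d n) - sup_process b (v \<omega>) (d n)\<bar> \<le> r)" for \<omega> r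
      unfolding mdist_cube_C_le[OF q Xin]
      using q Xin[of \<omega>] by (intro dense) (auto simp: mspace_cube_C intro!: continuous_intros)
    then show "(\<lambda>\<omega>. mdist cube_C q (sup_process b (v \<omega>))) \<in> borel_measurable M"
      by (subst borel_measurable_iff_le) simp
  qed (use Xin in auto)
qed

lemma measurable_CM3:
  fixes a :: "nat \<Rightarrow> int \<Rightarrow> real^'q \<Rightarrow> real"
  assumes "\<And>i j. continuous_on unit_cube (a i j)"
    and "\<And>i j. Z (t - int i) j \<in> borel_measurable M"
  shows "CM3 a Z t \<in> measurable M (metric_borel cube_C)"
proof -
  have "(\<lambda>\<omega>. sup_process (\<lambda>(i, j). a i j) (\<lambda>(i, j). Z (t - int i) j \<omega>)) \<in> measurable M (metric_borel cube_C)"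
    using assms by (intro measurable_sup_process) (auto split: prod.splits)
  then show ?thesis by (simp add: CM3_eq_sup_process cong: measurable_cong)
qed

section \<open>Sums, tails and perturbed events\<close>

lemma (in finite_measure) measure_UN_le_infsum:
  fixes f :: "'i::countable \<Rightarrow> real"
  assumes "\<And>i. i \<in> I \<Longrightarrow> A i \<in> sets M" "\<And>i. i \<in> I \<Longrightarrow> measure M (A i) \<le> f i"
    and f: "f summable_on I"
  shows "measure M (\<Union>i\<in>I. A i) \<le> infsum f I"
proof -
  define J where "J n = {i\<in>I. to_nat i < n}" for n
  have fin: "finite (J n)" for n
    unfolding J_def by (rule finite_subset[of _ "to_nat -` {..<n}"]) (auto intro: finite_vimageI)
  have f0: "0 \<le> f i" if "i \<in> I" for i
    using assms(2)[OF that] measure_nonneg order_trans by blast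
  have ev: "(\<Union>i\<in>J n. A i) \<in> sets M" for n
    using fin assms(1) by (auto simp: J_def)
  have "(\<lambda>n. measure M (\<Union>i\<in>J n. A i)) \<longlonglongrightarrow> measure M (\<Union>n. \<Union>i\<in>J n. A i)"
  proof (rule finite_Lim_measure_incseq)
    show "range (\<lambda>n. \<Union>i\<in>J n. A i) \<subseteq> sets M" using ev by auto
    show "incseq (\<lambda>n. \<Union>i\<in>J n. A i)" unfolding incseq_def J_def by fastforce
  qed
  moreover have "measure M (\<Union>i\<in>J n. A i) \<le> infsum f I" for n
  proof -
    have "measure M (\<Union>i\<in>J n. A i) \<le> (\<Sum>i\<in>J n. measure M (A i))"
      using fin assms(1) by (intro finite_measure_subadditive_finite) (auto simp: J_def)
    also have "\<dots> \<le> (\<Sum>i\<in>J n. f i)" using assms(2) by (intro sum_mono) (auto simp: J_def)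
    also have "\<dots> \<le> infsum f I"
      using f fin f0 by (intro finite_sum_le_infsum) (auto simp: J_def)
    finally show ?thesis .
  qed
  moreover have "(\<Union>n. \<Union>i\<in>J n. A i) = (\<Union>i\<in>I. A i)"
    by (auto simp: J_def)
  ultimately show ?thesis by (metis (lifting) LIMSEQ_le_const2)
qed

text \<open>Finitely many terms carry the sum up to \<open>\<epsilon>\<close>, and all of these have bounded level.\<close>

lemma infsum_tail_tendsto_0:
  fixes f :: "'i \<Rightarrow> real" and level :: "'i \<Rightarrow> nat"
  assumes f: "f summable_on UNIV" and f0: "\<And>i. 0 \<le> f i"
  shows "(\<lambda>m. infsum f {i. m \<le> level i}) \<longlonglongrightarrow> 0"
proof (rule LIMSEQ_I)
  fix e :: real assume e: "0 < e"
  have summ: "f summable_on S" for S using summable_on_subset_banach[OF f] by simp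
  have "\<forall>\<^sub>F F in finite_subsets_at_top UNIV. infsum f UNIV - e < sum f F"
    using order_tendstoD(1)[OF infsum_tendsto[OF f]] e by simp
  then obtain F where F: "finite F" "infsum f UNIV - e < sum f F"
    by (auto simp: eventually_finite_subsets_at_top)
  show "\<exists>m0. \<forall>m\<ge>m0. norm (infsum f {i. m \<le> level i} - 0) < e"
  proof (intro exI[of _ "Suc (Max (insert 0 (level ` F)))"] allI impI)
    fix m assume "Suc (Max (insert 0 (level ` F))) \<le> m"
    then have "F \<subseteq> {i. level i < m}"
      using F(1) Max_ge[of "insert 0 (level ` F)"] by (fastforce simp: less_eq_Suc_le[symmetric] intro: le_less_trans)
    then have "sum f F \<le> infsum f {i. level i < m}"
      using F(1) f0 summ by (intro finite_sum_le_infsum) auto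
    moreover have "infsum f UNIV = infsum f {i. level i < m} + infsum f {i. m \<le> level i}"
      using infsum_Un_disjoint[OF summ summ, of "{i. level i < m}" "{i. m \<le> level i}"]
      by (simp add: Un_def disjoint_iff not_less) (metis (mono_tags, lifting) UNIV_eq_I linorder_not_le mem_Collect_eq)
    moreover have "0 \<le> infsum f {i. m \<le> level i}" using f0 by (intro infsum_nonneg)
    ultimately show "norm (infsum f {i. m \<le> level i} - 0) < e" using F(2) by simp
  qed
qed

lemma (in prob_space) prob_diff_le_of_eq_outside:
  assumes [measurable]: "A \<in> events" "B \<in> events" "E \<in> events" and eq: "A - E = B - E"
  shows "\<bar>prob A - prob B\<bar> \<le> prob E"
proof -
  have "prob A \<le> prob B + prob E" if "A \<subseteq> B \<union> E" "B \<in> events" for A B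
    using finite_measure_mono[OF that(1)] measure_Un_le[of B M E] that by force
  from this[of A B] this[of B A] show ?thesis using eq by force
qed

text \<open>If two processes agree off \<open>E\<close>, then each event of one is matched, off \<open>E\<close>, by the event of the other
that is built by the same set operations. This avoids representing events by sets of whole paths.\<close>

lemma gen_sigma_eq_outside:
  assumes A: "A \<in> gen_sigma M N X T"
    and eq: "\<And>t \<omega>. t \<in> T \<Longrightarrow> \<omega> \<in> space M - E \<Longrightarrow> X t \<omega> = Y t \<omega>"
  shows "\<exists>B\<in>gen_sigma M N Y T. A - E = B - E"
  using A unfolding gen_sigma_def
proof (induction rule: sigma_sets.induct)
  case (Basic A)
  then obtain t U where "t \<in> T" "U \<in> sets N" "A = X t -` U \<inter> space M" by auto
  then show ?case
    using eq by (intro bexI[of _ "Y t -` U \<inter> space M"] sigma_sets.Basic) auto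
next
  case Empty
  then show ?case by (intro bexI[of _ "{}"] sigma_sets.Empty) auto
next
  case (Compl A)
  then obtain B where B: "B \<in> sigma_sets (space M) (\<Union>t\<in>T. {Y t -` B \<inter> space M |B. B \<in> sets N})"
    "A - E = B - E" by auto
  have "space M - A - E = space M - B - E" using B(2) by blast
  then show ?case using B(1) by (blast intro: sigma_sets.Compl)
next
  case (Union A)
  let ?S = "sigma_sets (space M) (\<Union>t\<in>T. {Y t -` B \<inter> space M |B. B \<in> sets N})"
  have "\<forall>i. \<exists>B. B \<in> ?S \<and> A i - E = B - E" using Union.IH by blast
  then obtain B where B: "\<forall>i. B i \<in> ?S \<and> A i - E = B i - E" unfolding choice_iff by blast
  then have "(\<Union>i. B i) \<in> ?S" by (intro sigma_sets.Union) blast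
  moreover have "(\<Union>i. A i) - E = (\<Union>i. B i) - E" using B by blast
  ultimately show ?case by blast
qed

lemma gen_sigma_subset_sets:
  assumes "\<And>t. t \<in> T \<Longrightarrow> X t \<in> measurable G N" "space G = space M"
  shows "gen_sigma M N X T \<subseteq> sets G"
  unfolding gen_sigma_def assms(2)[symmetric]
  using assms(1) by (intro sets.sigma_sets_subset) (auto intro: measurable_sets)

section \<open>Independent noise\<close>

text \<open>The \<open>\<sigma>\<close>-field generated by a subfamily of the noise variables. It is packaged as a measure so that
measurability of functions with respect to it can be expressed.\<close>

definition generated :: "'w measure \<Rightarrow> ('i \<Rightarrow> 'w \<Rightarrow> real) \<Rightarrow> 'i set \<Rightarrow> 'w measure"
  where "generated M V I = sigma (space M) (\<Union>i\<in>I. {V i -` B \<inter> space M |B. B \<in> sets borel})"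

lemma space_generated: "space (generated M V I) = space M"
  unfolding generated_def by (rule space_measure_of) auto

lemma sets_generated:
  "sets (generated M V I) = sigma_sets (space M) (\<Union>i\<in>I. {V i -` B \<inter> space M |B. B \<in> sets borel})"
  unfolding generated_def by (rule sets_measure_of) auto

lemma measurable_generated:
  assumes "i \<in> I"
  shows "V i \<in> borel_measurable (generated M V I)"
proof (rule measurableI)
  fix B :: "real set" assume "B \<in> sets borel"
  then show "V i -` B \<inter> space (generated M V I) \<in> sets (generated M V I)"
    using assms unfolding space_generated sets_generated by (blast intro: sigma_sets.Basic)
qed simp

lemma (in prob_space) prob_Int_generated:
  assumes indep: "indep_vars (\<lambda>_. borel) V UNIV" and disj: "I \<inter> J = {}"
    and A: "A \<in> sets (generated M V I)" and B: "B \<in> sets (generated M V J)"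
  shows "prob (A \<inter> B) = prob A * prob B"
proof -
  have "indep_sets (\<lambda>b. sigma_sets (space M)
      (\<Union>i\<in>(case b of True \<Rightarrow> I | False \<Rightarrow> J). {V i -` B \<inter> space M |B. B \<in> sets borel})) UNIV"
  proof (rule indep_sets_collect_sigma)
    show "indep_sets (\<lambda>i. {V i -` B \<inter> space M |B. B \<in> sets borel})
        (\<Union>b\<in>UNIV. case b of True \<Rightarrow> I | False \<Rightarrow> J)"
      using indep unfolding indep_vars_def2 by (auto intro: indep_sets_mono_index)
    show "disjoint_family (case_bool I J)"
      using disj by (auto simp: disjoint_family_on_def split: bool.split)
    show "Int_stable {V i -` B \<inter> space M |B. B \<in> sets borel}" for i
    proof (rule Int_stableI)
      fix a b assume "a \<in> {V i -` B \<inter> space M |B. B \<in> sets borel}" "b \<in> {V i -` B \<inter> space M |B. B \<in> sets borel}"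
      then obtain B C where "a = V i -` B \<inter> space M" "b = V i -` C \<inter> space M" "B \<in> sets borel" "C \<in> sets borel"
        by auto
      then show "a \<inter> b \<in> {V i -` B \<inter> space M |B. B \<in> sets borel}"
        by (intro CollectI exI[of _ "B \<inter> C"]) auto
    qed
  qed
  from indep_setsD[OF this, of UNIV "case_bool A B"] show ?thesis
    using A B by (simp add: UNIV_bool sets_generated ac_simps)
qed

section \<open>Comparison of Frechet variables\<close>

lemma (in prob_space) unit_Frechet_nonpos:
  assumes "unit_Frechet M Y"
  shows "prob {\<omega>\<in>space M. Y \<omega> \<le> 0} = 0"
proof -
  have [measurable]: "Y \<in> borel_measurable M" using assms by (simp add: unit_Frechet_def)
  have "prob {\<omega>\<in>space M. Y \<omega> \<le> 0} \<le> exp (-1) ^ n" for n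
  proof (cases "n = 0")
    case False
    have "prob {\<omega>\<in>space M. Y \<omega> \<le> 0} \<le> prob {\<omega>\<in>space M. Y \<omega> \<le> 1 / n}"
      by (intro finite_measure_mono subsetI) (auto intro: order_trans)
    also have "\<dots> = exp (-1) ^ n"
      using assms False by (simp add: unit_Frechet_def exp_of_nat_mult[symmetric])
    finally show ?thesis .
  qed simp
  moreover have "(\<lambda>n. exp (-1::real) ^ n) \<longlonglongrightarrow> 0" by (rule LIMSEQ_realpow_zero) auto
  ultimately have "prob {\<omega>\<in>space M. Y \<omega> \<le> 0} \<le> 0" by (meson LIMSEQ_le_const)
  then show ?thesis by (simp add: measure_le_0_iff)
qed

text \<open>The reciprocals \<open>1/W\<close> and \<open>1/Y\<close> are independent standard exponential variables, so the event is, up to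
a null event, \<open>1/Y < l \<cdot> (1/W)\<close>, whose probability is at most linear in \<open>l\<close>. Slicing according to the integer part
\<open>n\<close> of \<open>1/W\<close> gives this from the distribution functions alone: the \<open>n\<close>-th slice forces \<open>W \<le> 1/n\<close>, which has
probability \<open>e\<^sup>-\<^sup>n\<close>, and \<open>Y > 1/(l (n+1))\<close>, which has probability at most \<open>l (n+1)\<close>. The sum
\<open>\<Sum>\<^sub>n (n+1) q\<^sup>n\<close> with \<open>q = e\<^sup>-\<^sup>1\<close> produces the constant.\<close>

lemma (in prob_space) prob_Frechet_less_le:
  assumes W: "unit_Frechet M W" and Y: "unit_Frechet M Y"
    and indep: "\<And>A B. A \<in> sets borel \<Longrightarrow> B \<in> sets borel \<Longrightarrow>
      prob ((W -` A \<inter> space M) \<inter> (Y -` B \<inter> space M)) = prob (W -` A \<inter> space M) * prob (Y -` B \<inter> space M)"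
    and l: "0 < l"
  shows "prob {\<omega>\<in>space M. W \<omega> < l * Y \<omega>} \<le> l / (1 - exp (-1))\<^sup>2"
proof -
  define q :: real where "q = exp (-1)"
  have [measurable]: "W \<in> borel_measurable M" "Y \<in> borel_measurable M"
    using W Y by (auto simp: unit_Frechet_def)
  \<comment> \<open>At \<open>n = 0\<close> the bound \<open>1 / n\<close> would read \<open>0\<close>, so \<open>A 0\<close> is set to the whole space.\<close>
  define A where "A n = W -` {w. n = 0 \<or> w \<le> 1 / real n} \<inter> space M" for n :: nat
  define B where "B n = Y -` {y. 1 / (l * real (Suc n)) < y} \<inter> space M" for n :: nat
  have [measurable]: "A n \<in> events" "B n \<in> events" for n
    unfolding A_def B_def by measurable
  have PA: "prob (A n) \<le> q ^ n" for n
  proof (cases "n = 0")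
    case False
    then have "prob (A n) = prob {\<omega>\<in>space M. W \<omega> \<le> 1 / n}"
      by (intro arg_cong[where f = prob]) (auto simp: A_def)
    then show ?thesis
      using W False by (simp add: unit_Frechet_def q_def exp_of_nat_mult[symmetric])
  qed simp
  have PB: "prob (B n) \<le> l * real (Suc n)" for n
  proof -
    have "B n = space M - {\<omega>\<in>space M. Y \<omega> \<le> 1 / (l * real (Suc n))}" by (auto simp: B_def)
    then have "prob (B n) = 1 - prob {\<omega>\<in>space M. Y \<omega> \<le> 1 / (l * real (Suc n))}"
      by (simp add: prob_compl)
    also have "\<dots> = 1 - exp (- (l * real (Suc n)))"
      using Y l by (simp add: unit_Frechet_def del: of_nat_Suc)
    also have "\<dots> \<le> l * real (Suc n)" using exp_ge_add_one_self[of "- (l * real (Suc n))"] by simp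
    finally show ?thesis .
  qed
  have PAB: "prob (A n \<inter> B n) \<le> l * (real (Suc n) * q ^ n)" for n
  proof -
    have "prob (A n \<inter> B n) = prob (A n) * prob (B n)"
      unfolding A_def B_def by (rule indep) measurable
    also have "\<dots> \<le> q ^ n * (l * real (Suc n))"
      using PA PB by (intro mult_mono) (auto simp: q_def)
    finally show ?thesis by (simp add: mult_ac)
  qed
  have sums: "(\<lambda>n. l * (real (Suc n) * q ^ n)) sums (l * (1 / (1 - q)\<^sup>2))"
    by (intro sums_mult geometric_deriv_sums) (simp add: q_def)
  have summ: "summable (\<lambda>n. prob (A n \<inter> B n))"
    by (rule summable_comparison_test'[OF sums_summable[OF sums], of 0]) (use PAB in auto)
  have "{\<omega>\<in>space M. W \<omega> < l * Y \<omega>} \<subseteq> {\<omega>\<in>space M. W \<omega> \<le> 0} \<union> (\<Union>n. A n \<inter> B n)"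
  proof
    fix \<omega> assume w: "\<omega> \<in> {\<omega>\<in>space M. W \<omega> < l * Y \<omega>}"
    show "\<omega> \<in> {\<omega>\<in>space M. W \<omega> \<le> 0} \<union> (\<Union>n. A n \<inter> B n)"
    proof (cases "W \<omega> \<le> 0")
      case False
      define n where "n = nat \<lfloor>1 / W \<omega>\<rfloor>"
      have rn: "real n = of_int \<lfloor>1 / W \<omega>\<rfloor>" using False by (simp add: n_def)
      have n: "real n \<le> 1 / W \<omega>" "1 / W \<omega> < real (Suc n)"
        unfolding of_nat_Suc rn by linarith+
      have "W \<omega> \<le> 1 / real n" if "n \<noteq> 0" using that False n(1) by (simp add: field_simps)
      then have "\<omega> \<in> A n" using w by (auto simp: A_def)
      moreover have "1 / real (Suc n) < W \<omega>"
        using n(2) False by (simp add: field_simps)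
      then have "1 / real (Suc n) < l * Y \<omega>" using w by simp
      then have "1 / real (Suc n) / l < Y \<omega>" using divide_strict_right_mono[OF _ l] l by fastforce
      then have "1 / (l * real (Suc n)) < Y \<omega>" by (metis divide_divide_eq_left mult.commute)
      then have "\<omega> \<in> B n" using w by (simp add: B_def)
      ultimately show ?thesis by auto
    qed (use w in auto)
  qed
  then have "prob {\<omega>\<in>space M. W \<omega> < l * Y \<omega>} \<le> prob ({\<omega>\<in>space M. W \<omega> \<le> 0} \<union> (\<Union>n. A n \<inter> B n))"
    by (intro finite_measure_mono) auto
  also have "\<dots> \<le> prob {\<omega>\<in>space M. W \<omega> \<le> 0} + prob (\<Union>n. A n \<inter> B n)"
    by (intro measure_Un_le) auto
  also have "\<dots> = prob (\<Union>n. A n \<inter> B n)" using unit_Frechet_nonpos[OF W] by simp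
  also have "\<dots> \<le> (\<Sum>n. prob (A n \<inter> B n))"
    using summ by (intro finite_measure_subadditive_countably) auto
  also have "\<dots> \<le> (\<Sum>n. l * (real (Suc n) * q ^ n))"
    by (rule suminf_le[OF PAB summ sums_summable[OF sums]])
  also have "\<dots> = l / (1 - exp (-1))\<^sup>2" using sums_unique[OF sums] by (simp add: q_def)
  finally show ?thesis .
qed

section \<open>Masking of the old noise and strong mixing\<close>

lemma le_cube_norm:
  assumes "continuous_on unit_cube f" "x \<in> unit_cube"
  shows "\<bar>f x\<bar> \<le> cube_norm f"
proof -
  have "compact ((\<lambda>x. \<bar>f x\<bar>) ` unit_cube)"
    using assms(1) by (intro compact_continuous_image continuous_intros compact_cbox)
  then have "bdd_above ((\<lambda>x. \<bar>f x\<bar>) ` unit_cube)"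
    by (intro bounded_imp_bdd_above compact_imp_bounded)
  then show ?thesis unfolding cube_norm_def using assms(2) by (rule cSUP_upper2) simp
qed

text \<open>Deleting the noise at times \<open>s \<le> 0\<close> gives a process driven by the later noise alone. The value \<open>0\<close> makes the
deleted terms harmless in a supremum that contains a nonnegative term.\<close>

definition after_zero :: "(int \<Rightarrow> int \<Rightarrow> 'w \<Rightarrow> real) \<Rightarrow> int \<Rightarrow> int \<Rightarrow> 'w \<Rightarrow> real"
  where "after_zero Z s j \<omega> = (if s > 0 then Z s j \<omega> else 0)"

text \<open>A deleted term is dominated, everywhere on the cube at once, by the term \<open>a 0 0 x * Z t 0 \<omega>\<close> of the newest
noise as soon as the sup-norm of its parameter function times the noise is below \<open>c * Z t 0 \<omega>\<close>. Then neither
the term nor the \<open>0\<close> that replaces it affects the supremum, so the processes agree exactly, including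
at those \<open>\<omega>\<close> where the process is reset to zero.\<close>

lemma CM3_eq_after_zero:
  fixes a :: "nat \<Rightarrow> int \<Rightarrow> real^'q \<Rightarrow> real"
  assumes cont: "\<And>i j. continuous_on unit_cube (a i j)"
    and pos: "\<And>i j x. x \<in> unit_cube \<Longrightarrow> 0 < a i j x"
    and c: "0 < c" "\<And>x. x \<in> unit_cube \<Longrightarrow> c \<le> a 0 0 x"
    and t: "0 < t" and Z0: "0 \<le> Z t 0 \<omega>"
    and dom: "\<And>i j. t \<le> int i \<Longrightarrow> cube_norm (a i j) / c * Z (t - int i) j \<omega> \<le> Z t 0 \<omega>"
  shows "CM3 a Z t \<omega> = CM3 a (after_zero Z) t \<omega>"
proof -
  have "CM3_sup a Z t \<omega> x = CM3_sup a (after_zero Z) t \<omega> x" if x: "x \<in> unit_cube" for x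
  proof (rule antisym)
    have lead: "c * Z t 0 \<omega> \<le> a 0 0 x * Z t 0 \<omega>"
      using c(2)[OF x] Z0 by (rule mult_right_mono)
    have old: "a i j x * Z (t - int i) j \<omega> \<le> a 0 0 x * Z t 0 \<omega>" if i: "t \<le> int i" for i j
    proof (cases "0 \<le> Z (t - int i) j \<omega>")
      case True
      have "a i j x * Z (t - int i) j \<omega> \<le> cube_norm (a i j) * Z (t - int i) j \<omega>"
        using le_cube_norm[OF cont x, of i j] True by (intro mult_right_mono) auto
      also have "\<dots> \<le> c * Z t 0 \<omega>" using dom[OF i, of j] c(1) by (simp add: field_simps)
      finally show ?thesis using lead by linarith
    next
      case False
      then have "a i j x * Z (t - int i) j \<omega> \<le> 0"
        using pos[OF x, of i j] by (simp add: mult_le_0_iff)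
      also have "0 \<le> a 0 0 x * Z t 0 \<omega>" using pos[OF x, of 0 0] Z0 by simp
      finally show ?thesis .
    qed
    have "ereal (a i j x * Z (t - int i) j \<omega>) \<le> CM3_sup a (after_zero Z) t \<omega> x" for i j
    proof (cases "t \<le> int i")
      case True
      show ?thesis unfolding CM3_sup_def
        by (intro SUP_upper2[of 0 UNIV] UNIV_I) (use old[OF True, of j] t in \<open>simp add: after_zero_def\<close>)
    next
      case False
      then show ?thesis unfolding CM3_sup_def
        by (intro SUP_upper2[of j UNIV] SUP_upper2[of i UNIV]) (auto simp: after_zero_def)
    qed
    then show "CM3_sup a Z t \<omega> x \<le> CM3_sup a (after_zero Z) t \<omega> x"
      unfolding CM3_sup_def[of a Z] by (intro SUP_least)
  next
    have "ereal (a i j x * after_zero Z (t - int i) j \<omega>) \<le> CM3_sup a Z t \<omega> x" for i j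
    proof (cases "t \<le> int i")
      case True
      have "0 \<le> ereal (a 0 0 x * Z (t - int 0) 0 \<omega>)" using pos[OF x, of 0 0] Z0 by simp
      also have "\<dots> \<le> CM3_sup a Z t \<omega> x"
        unfolding CM3_sup_def by (intro SUP_upper2[of 0 UNIV]) auto
      finally show ?thesis using True by (simp add: after_zero_def zero_ereal_def)
    next
      case False
      then show ?thesis unfolding CM3_sup_def
        by (intro SUP_upper2[of j UNIV] SUP_upper2[of i UNIV]) (auto simp: after_zero_def)
    qed
    then show "CM3_sup a (after_zero Z) t \<omega> x \<le> CM3_sup a Z t \<omega> x"
      unfolding CM3_sup_def[of a "after_zero Z"] by (intro SUP_least)
  qed
  then show ?thesis by (simp add: CM3_def cong: restrict_cong ball_cong)
qed

text \<open>Off this event the noise at times \<open>s \<le> 0\<close> is masked by the newest noise at every time \<open>t \<ge> m\<close>, in the sense of the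
previous lemma. The null events on which the newest noise is not positive are included, because masking needs
its term to be nonnegative.\<close>

definition old_noise_visible ::
    "'w measure \<Rightarrow> (nat \<Rightarrow> int \<Rightarrow> real^'q \<Rightarrow> real) \<Rightarrow> (int \<Rightarrow> int \<Rightarrow> 'w \<Rightarrow> real) \<Rightarrow> real \<Rightarrow> nat \<Rightarrow> 'w set"
  where "old_noise_visible M a Z c m =
    {\<omega>\<in>space M. \<exists>t\<ge>m. Z (int t) 0 \<omega> \<le> 0 \<or>
      (\<exists>i\<ge>t. \<exists>j. Z (int t) 0 \<omega> < cube_norm (a i j) / c * Z (int t - int i) j \<omega>)}"

text \<open>For a fixed pair \<open>(j, i)\<close> the term with parameter \<open>a i j\<close> reaches back to a time \<open>s \<le> 0\<close> only from the times
\<open>t = m, \<dots>, i\<close>, and each such \<open>t\<close> costs at most a multiple of \<open>cube_norm (a i j) / c\<close> by the comparison of two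
independent Frechet variables. Summing over the at most \<open>i\<close> values of \<open>t\<close> is where the weight \<open>i\<close>
in the hypothesis comes from.\<close>

lemma (in prob_space) prob_old_noise_visible_le:
  fixes a :: "nat \<Rightarrow> int \<Rightarrow> real^'q \<Rightarrow> real"
  assumes cont: "\<And>i j. continuous_on unit_cube (a i j)"
    and pos: "\<And>i j x. x \<in> unit_cube \<Longrightarrow> 0 < a i j x"
    and Z: "\<And>i j. unit_Frechet M (Z i j)"
    and indep: "indep_vars (\<lambda>_. borel) (\<lambda>(i, j). Z i j) UNIV"
    and summ: "(\<lambda>(j, i). real i * cube_norm (a i j)) summable_on UNIV"
    and c: "0 < c" and m: "0 < m"
  shows "prob (old_noise_visible M a Z c m) \<le>
    1 / (c * (1 - exp (-1))\<^sup>2) * infsum (\<lambda>(j, i). real i * cube_norm (a i j)) {k. m \<le> snd k}"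
    and "old_noise_visible M a Z c m \<in> events"
proof -
  define K where "K = 1 / (c * (1 - exp (-1::real))\<^sup>2)"
  have [measurable]: "Z i j \<in> borel_measurable M" for i j using Z by (simp add: unit_Frechet_def)
  define N where "N = (\<Union>t\<in>{m..}. {\<omega>\<in>space M. Z (int t) 0 \<omega> \<le> 0})"
  define A where "A = (\<lambda>(j, i) t. {\<omega>\<in>space M. Z (int t) 0 \<omega> < cube_norm (a i j) / c * Z (int t - int i) j \<omega>})"
  have [measurable]: "A k t \<in> events" for k t
    unfolding A_def by (cases k) simp
  have E: "old_noise_visible M a Z c m = N \<union> (\<Union>k\<in>{k. m \<le> snd k}. \<Union>t\<in>{m..snd k}. A k t)"
  proof -
    have N_iff: "\<omega> \<in> N \<longleftrightarrow> \<omega> \<in> space M \<and> (\<exists>t\<ge>m. Z (int t) 0 \<omega> \<le> 0)" for \<omega>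
      by (auto simp: N_def)
    have A_iff: "\<omega> \<in> (\<Union>k\<in>{k. m \<le> snd k}. \<Union>t\<in>{m..snd k}. A k t) \<longleftrightarrow> \<omega> \<in> space M \<and>
        (\<exists>t\<ge>m. \<exists>i\<ge>t. \<exists>j. Z (int t) 0 \<omega> < cube_norm (a i j) / c * Z (int t - int i) j \<omega>)" for \<omega>
    proof -
      have "\<omega> \<in> (\<Union>k\<in>{k. m \<le> snd k}. \<Union>t\<in>{m..snd k}. A k t) \<longleftrightarrow>
          (\<exists>t i j. m \<le> t \<and> t \<le> i \<and> \<omega> \<in> A (j, i) t)"
      proof
        assume "\<omega> \<in> (\<Union>k\<in>{k. m \<le> snd k}. \<Union>t\<in>{m..snd k}. A k t)"
        then obtain k t where "t \<in> {m..snd k}" "\<omega> \<in> A k t" by blast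
        then show "\<exists>t i j. m \<le> t \<and> t \<le> i \<and> \<omega> \<in> A (j, i) t"
          by (intro exI[of _ t] exI[of _ "snd k"] exI[of _ "fst k"]) simp
      next
        assume "\<exists>t i j. m \<le> t \<and> t \<le> i \<and> \<omega> \<in> A (j, i) t"
        then obtain t i j where "m \<le> t" "t \<le> i" "\<omega> \<in> A (j, i) t" by blast
        then show "\<omega> \<in> (\<Union>k\<in>{k. m \<le> snd k}. \<Union>t\<in>{m..snd k}. A k t)"
          by (intro UN_I[of "(j, i)"] UN_I[of t]) auto
      qed
      then show ?thesis unfolding A_def by auto
    qed
    show ?thesis
      by (rule set_eqI, simp only: old_noise_visible_def Un_iff mem_Collect_eq N_iff A_iff) blast
  qed
  have evN: "N \<in> events" unfolding N_def by measurable
  have evA: "(\<Union>k\<in>{k. m \<le> snd k}. \<Union>t\<in>{m..snd k}. A k t) \<in> events"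
    by (intro sets.countable_UN'' sets.finite_UN) auto
  show "old_noise_visible M a Z c m \<in> events" unfolding E using evN evA by blast
  have "prob N \<le> infsum (\<lambda>_. 0) {m..}"
    unfolding N_def using unit_Frechet_nonpos[OF Z] by (intro measure_UN_le_infsum) auto
  then have N: "prob N = 0" by (simp add: measure_le_0_iff)
  have norm_pos: "0 < cube_norm (a i j)" for i j
  proof -
    have "(0 :: real^'q) \<in> unit_cube" by (auto simp: mem_box_cart)
    then have "0 < a i j 0" "\<bar>a i j 0\<bar> \<le> cube_norm (a i j)" using pos le_cube_norm[OF cont] by blast+
    then show ?thesis by linarith
  qed
  have PA: "prob (A (j, i) t) \<le> K * cube_norm (a i j)" if t: "t \<in> {m..i}" for i j t
  proof -
    have "prob {\<omega>\<in>space M. Z (int t) 0 \<omega> < cube_norm (a i j) / c * Z (int t - int i) j \<omega>}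
        \<le> cube_norm (a i j) / c / (1 - exp (-1))\<^sup>2"
    proof (rule prob_Frechet_less_le[OF Z Z])
      fix B C :: "real set" assume B: "B \<in> sets borel" and C: "C \<in> sets borel"
      let ?V = "\<lambda>(i, j). Z i j"
      have "?V (int t, 0) -` B \<inter> space M \<in> sets (generated M ?V {(int t, 0)})"
        "?V (int t - int i, j) -` C \<inter> space M \<in> sets (generated M ?V {(int t - int i, j)})"
        using measurable_sets[OF measurable_generated B, of "(int t, 0)" "{(int t, 0)}" ?V M]
          measurable_sets[OF measurable_generated C, of "(int t - int i, j)" "{(int t - int i, j)}" ?V M]
        by (simp_all add: space_generated)
      moreover have "{(int t, 0)} \<inter> {(int t - int i, j)} = {}" using t m by auto
      ultimately have "prob ((?V (int t, 0) -` B \<inter> space M) \<inter> (?V (int t - int i, j) -` C \<inter> space M)) =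
          prob (?V (int t, 0) -` B \<inter> space M) * prob (?V (int t - int i, j) -` C \<inter> space M)"
        by (intro prob_Int_generated[OF indep])
      then show "prob ((Z (int t) 0 -` B \<inter> space M) \<inter> (Z (int t - int i) j -` C \<inter> space M)) =
          prob (Z (int t) 0 -` B \<inter> space M) * prob (Z (int t - int i) j -` C \<inter> space M)"
        by simp
    qed (use norm_pos c in simp)
    then show ?thesis by (simp add: A_def K_def)
  qed
  have "prob (old_noise_visible M a Z c m) \<le> prob N + prob (\<Union>k\<in>{k. m \<le> snd k}. \<Union>t\<in>{m..snd k}. A k t)"
    unfolding E using evN evA by (rule measure_Un_le)
  also have "\<dots> \<le> infsum (\<lambda>k. K * (case k of (j, i) \<Rightarrow> real i * cube_norm (a i j))) {k. m \<le> snd k}"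
    unfolding N add_0
  proof (rule measure_UN_le_infsum)
    fix k :: "int \<times> nat" assume k: "k \<in> {k. m \<le> snd k}"
    obtain j i where ji: "k = (j, i)" by (cases k)
    have "prob (\<Union>t\<in>{m..i}. A (j, i) t) \<le> (\<Sum>t\<in>{m..i}. prob (A (j, i) t))"
      by (intro finite_measure_subadditive_finite) auto
    also have "\<dots> \<le> (\<Sum>t\<in>{m..i}. K * cube_norm (a i j))" by (intro sum_mono PA)
    also have "\<dots> = real (card {m..i}) * (K * cube_norm (a i j))" by simp
    also have "\<dots> \<le> real i * (K * cube_norm (a i j))"
      using m norm_pos[of i j] c by (intro mult_right_mono) (auto simp: K_def)
    finally show "prob (\<Union>t\<in>{m..snd k}. A k t) \<le> K * (case k of (j, i) \<Rightarrow> real i * cube_norm (a i j))"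
      by (simp add: ji mult_ac)
  qed (use summable_on_cmult_right[OF summable_on_subset_banach[OF summ]] in auto)
  also have "\<dots> = K * infsum (\<lambda>(j, i). real i * cube_norm (a i j)) {k. m \<le> snd k}"
    by (rule infsum_cmult_right')
  finally show "prob (old_noise_visible M a Z c m) \<le>
    1 / (c * (1 - exp (-1))\<^sup>2) * infsum (\<lambda>(j, i). real i * cube_norm (a i j)) {k. m \<le> snd k}"
    by (simp add: K_def)
qed

text \<open>Past events depend on the noise at times \<open>s \<le> 0\<close>. A future event \<open>B\<close> agrees, off the exceptional event, with
an event \<open>B'\<close> that depends on the noise at times \<open>s > 0\<close> and is therefore independent of the past.
Exchanging \<open>B\<close> and \<open>B'\<close> costs one exceptional probability in \<open>P(A \<inter> B)\<close> and one in \<open>P(A) P(B)\<close>.\<close>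

lemma (in prob_space) mixing_coeff_CM3_le:
  fixes a :: "nat \<Rightarrow> int \<Rightarrow> real^'q \<Rightarrow> real"
  assumes cont: "\<And>i j. continuous_on unit_cube (a i j)"
    and pos: "\<And>i j x. x \<in> unit_cube \<Longrightarrow> 0 < a i j x"
    and Z: "\<And>i j. random_variable borel (Z i j)"
    and indep: "indep_vars (\<lambda>_. borel) (\<lambda>(i, j). Z i j) UNIV"
    and c: "0 < c" "\<And>x. x \<in> unit_cube \<Longrightarrow> c \<le> a 0 0 x"
    and m: "0 < m" and ev: "old_noise_visible M a Z c m \<in> events"
  shows "\<bar>mixing_coeff M (metric_borel cube_C) (CM3 a Z) m\<bar> \<le> 2 * prob (old_noise_visible M a Z c m)"
proof -
  let ?N = "metric_borel cube_C :: (real^'q \<Rightarrow> real) measure" and ?V = "\<lambda>(i, j). Z i j"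
  let ?P = "gen_sigma M ?N (CM3 a Z) {..- int m}" and ?F = "gen_sigma M ?N (CM3 a Z) {int m..}"
  let ?E = "old_noise_visible M a Z c m"
  define past where "past = generated M ?V {(s, j). s \<le> 0}"
  define future where "future = generated M ?V {(s, j). 0 < s}"
  have space: "space past = space M" "space future = space M"
    by (simp_all add: past_def future_def space_generated)
  have Zpast: "Z s j \<in> borel_measurable past" if "s \<le> 0" for s j
    using measurable_generated[of "(s, j)" "{(s, j). s \<le> 0}" ?V M] that by (simp add: past_def)
  have Zfuture: "Z s j \<in> borel_measurable future" if "0 < s" for s j
    using measurable_generated[of "(s, j)" "{(s, j). 0 < s}" ?V M] that by (simp add: future_def)
  have zero_future: "after_zero Z s j \<in> borel_measurable future" for s j
    using Zfuture[of s j] by (cases "0 < s") (simp_all add: after_zero_def[abs_def])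
  have P: "?P \<subseteq> sets past"
    by (intro gen_sigma_subset_sets measurable_CM3 cont Zpast) (auto simp: space)
  have F': "gen_sigma M ?N (CM3 a (after_zero Z)) {int m..} \<subseteq> sets future"
    by (intro gen_sigma_subset_sets measurable_CM3 cont zero_future) (auto simp: space)
  have PM: "?P \<subseteq> events" and FM: "?F \<subseteq> events"
    by (intro gen_sigma_subset_sets measurable_CM3 cont Z refl)+
  have FM': "gen_sigma M ?N (CM3 a (after_zero Z)) {int m..} \<subseteq> events"
    by (intro gen_sigma_subset_sets measurable_CM3 cont refl) (use Z in \<open>simp add: after_zero_def[abs_def]\<close>)
  have eq: "CM3 a Z t \<omega> = CM3 a (after_zero Z) t \<omega>" if t: "t \<in> {int m..}" and w: "\<omega> \<in> space M - ?E" for t \<omega>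
  proof (rule CM3_eq_after_zero[where a = a and c = c, OF cont pos c])
    obtain n where n: "t = int n" "m \<le> n" using t nonneg_int_cases[of t] by auto
    show "0 < t" using t m by simp
    show "0 \<le> Z t 0 \<omega>" using w n unfolding old_noise_visible_def mem_Collect_eq by force
    show "cube_norm (a i j) / c * Z (t - int i) j \<omega> \<le> Z t 0 \<omega>" if "t \<le> int i" for i j
    proof (rule ccontr)
      assume "\<not> ?thesis"
      then have "Z (int n) 0 \<omega> < cube_norm (a i j) / c * Z (int n - int i) j \<omega>" "n \<le> i"
        using n that by simp_all
      then have "\<omega> \<in> ?E"
        using w n(2) unfolding old_noise_visible_def by blast
      then show False using w by simp
    qed
  qed
  have bound: "\<bar>prob (A \<inter> B) - prob A * prob B\<bar> \<le> 2 * prob ?E" if A: "A \<in> ?P" and B: "B \<in> ?F" for A B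
  proof -
    obtain B' where B': "B' \<in> gen_sigma M ?N (CM3 a (after_zero Z)) {int m..}" "B - ?E = B' - ?E"
      using gen_sigma_eq_outside[OF B eq] by blast
    have ev': "A \<in> events" "B \<in> events" "B' \<in> events" using A B B' PM FM FM' by auto
    have "prob (A \<inter> B') = prob A * prob B'"
      by (rule prob_Int_generated[OF indep, of "{(s, j). s \<le> 0}" "{(s, j). 0 < s}"])
         (use A B' P F' in \<open>auto simp: past_def future_def\<close>)
    then have "prob (A \<inter> B) - prob A * prob B = (prob (A \<inter> B) - prob (A \<inter> B')) - prob A * (prob B - prob B')"
      by (simp add: algebra_simps)
    also have "\<bar>\<dots>\<bar> \<le> \<bar>prob (A \<inter> B) - prob (A \<inter> B')\<bar> + prob A * \<bar>prob B - prob B'\<bar>"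
      using abs_triangle_ineq4 by (metis abs_mult abs_of_nonneg measure_nonneg)
    also have "\<dots> \<le> prob ?E + 1 * prob ?E"
    proof (intro add_mono mult_mono)
      show "\<bar>prob (A \<inter> B) - prob (A \<inter> B')\<bar> \<le> prob ?E"
        using ev ev' B'(2) by (intro prob_diff_le_of_eq_outside) blast+
      show "\<bar>prob B - prob B'\<bar> \<le> prob ?E"
        using ev ev' B'(2) by (intro prob_diff_le_of_eq_outside)
    qed auto
    finally show ?thesis by simp
  qed
  let ?f = "\<lambda>(A, B). \<bar>prob (A \<inter> B) - prob A * prob B\<bar>"
  have empty: "({}, {}) \<in> ?P \<times> ?F" by (auto simp: gen_sigma_def intro: sigma_sets.Empty)
  have "(SUP z\<in>?P \<times> ?F. ?f z) \<le> 2 * prob ?E"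
    using empty bound by (intro cSUP_least) auto
  moreover have "?f ({}, {}) \<le> (SUP z\<in>?P \<times> ?F. ?f z)"
  proof (rule cSUP_upper[OF empty])
    show "bdd_above (?f ` (?P \<times> ?F))"
      using bound by (intro bdd_aboveI[of _ "2 * prob ?E"]) auto
  qed
  ultimately show ?thesis unfolding mixing_coeff_def by simp
qed

theorem theorem2p5:
  fixes M :: "'w measure"
    and a :: "nat \<Rightarrow> int \<Rightarrow> real^'q \<Rightarrow> real"
    and Z :: "int \<Rightarrow> int \<Rightarrow> 'w \<Rightarrow> real"
  assumes "prob_space M"
    and "\<And>i j. continuous_on unit_cube (a i j)"
    and "\<And>i j x. x \<in> unit_cube \<Longrightarrow> a i j x > 0"
    and "\<And>i j. unit_Frechet M (Z i j)"
    and "prob_space.indep_vars M (\<lambda>_. borel) (\<lambda>(i, j). Z i j) UNIV"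
    and "(\<lambda>(j, i). cube_norm (a i j)) summable_on (UNIV :: (int \<times> nat) set)"
    and "(\<lambda>(j, i). real i * cube_norm (a i j)) summable_on (UNIV :: (int \<times> nat) set)"
  shows "strong_mixing M (metric_borel cube_C) (CM3 a Z)"
proof -
  interpret prob_space M by fact
  let ?f = "\<lambda>(j, i). real i * cube_norm (a i j)"
  have zero: "(0 :: real^'q) \<in> unit_cube" by (auto simp: mem_box_cart)
  then have norm: "0 \<le> cube_norm (a i j)" for i j
    using le_cube_norm[OF assms(2), of 0 i j] by simp
  obtain x where x: "x \<in> unit_cube" "\<And>y. y \<in> unit_cube \<Longrightarrow> a 0 0 x \<le> a 0 0 y"
    using continuous_attains_inf[OF compact_cbox, of 0 1 "a 0 0"] assms(2) zero by blast
  define c where "c = a 0 0 x"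
  have c: "0 < c" "\<And>y. y \<in> unit_cube \<Longrightarrow> c \<le> a 0 0 y" using x assms(3) by (auto simp: c_def)
  define K where "K = 1 / (c * (1 - exp (-1::real))\<^sup>2)"
  have rv: "random_variable borel (Z i j)" for i j using assms(4) by (simp add: unit_Frechet_def)
  have "\<bar>mixing_coeff M (metric_borel cube_C) (CM3 a Z) m\<bar> \<le> 2 * K * infsum ?f {k. m \<le> snd k}" if "0 < m" for m
    using mixing_coeff_CM3_le[where a = a and Z = Z and c = c and m = m, OF assms(2,3) rv assms(5) c that]
      prob_old_noise_visible_le[where a = a and Z = Z and c = c and m = m, OF assms(2-5,7) c(1) that] by (simp add: K_def)
  then have le: "\<forall>\<^sub>F m in sequentially.
      norm (mixing_coeff M (metric_borel cube_C) (CM3 a Z) m) \<le> 2 * K * infsum ?f {k. m \<le> snd k}"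
    by (intro eventually_sequentiallyI[of 1]) simp
  have "(\<lambda>m. infsum ?f {k. m \<le> snd k}) \<longlonglongrightarrow> 0"
    using norm by (intro infsum_tail_tendsto_0 assms(7)) auto
  then have "(\<lambda>m. 2 * K * infsum ?f {k. m \<le> snd k}) \<longlonglongrightarrow> 0"
    by (rule tendsto_mult_right_zero)
  then show ?thesis
    unfolding strong_mixing_def by (rule Lim_null_comparison[OF le])
qed

end
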